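(* Let $n$ be a sufficiently large prime and let $k, d \in \mathbb{N}$. For every $0 < \gamma < 1/2$, there exists $C = C(\gamma) > 0$ such that the following holds for all $m \ge (d + 1)k/2$ and all $\varepsilon$ with $C/k < \varepsilon < \gamma$. For each $d$-dimensional generalised arithmetic progression $P \subseteq \mathbb{Z}_n$, there exists a collection $\mathcal{F}$ of subsets of $P$ satisfying: (a) for every $F \in \mathcal{F}$, we have $|F| \le C \varepsilon^{-1} \sqrt{m \log m}$ and $|F \hat{+} F| \ge \frac{(1 - \gamma)(d + 1)k}{2}$; (b) for every $X \subseteq P$ with $|X| = k$, $|X \hat{+} X| \le m$ and $\varepsilon$-robust Freiman dimension $d$, there exists $F \in \mathcal{F}$ such that $F \subseteq X$.
   Context: For $X \subseteq \mathbb{Z}_n$, $X \hat{+} X = \{x_1 + x_2 : x_1, x_2 \in X, x_1 \ne x_2\}$. A $d$-dimensional generalised arithmetic progression in $\mathbb{Z}_n$ is a set of the form $\{a_0 + \sum_{i=1}^d w_i a_i : w_i \in \mathbb{Z}, 0 \le w_i < \ell_i\}$ with $a_0, \dots, a_d \in \mathbb{Z}_n$ and $\ell_1, \dots, \ell_d \in \mathbb{N}$. A Freiman homomorphism is a map $\phi : X \to Y$ between subsets of abelian groups such that $a_1 + b_1 = a_2 + b_2$ implies $\phi(a_1) + \phi(b_1) = \phi(a_2) + \phi(b_2)$ for all $a_1, a_2, b_1, b_2 \in X$; a Freiman isomorphism is a bijection $\phi$ such that $\phi$ and $\phi^{-1}$ are Freiman homomorphisms. A set $S \subseteq \mathbb{R}^d$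 has full rank if it is not contained in any affine subspace of dimension less than $d$. The Freiman dimension $\dim_{\mathrm{F}}(X)$ is the largest $d$ for which there is a full rank subset of $\mathbb{Z}^d$ Freiman isomorphic to $X$. $X$ has $\varepsilon$-robust Freiman dimension $d$ if $\dim_{\mathrm{F}}(X) \ge d$ and there is no $X' \subseteq X$ with $|X'| \ge (1 - \varepsilon)|X|$ and $\dim_{\mathrm{F}}(X') < d$. Floors and ceilings are omitted where not essential. *)

theory Defs
  imports
    "HOL-Computational_Algebra.Primes"
    "HOL-Analysis.Finite_Function_Topology"
    "HOL-Algebra.Elementary_Groups"
    "HOL-Algebra.Free_Abelian_Groups"
begin

text \<open>
  Abelian groups are HOL-Algebra groups, written multiplicatively: \<open>\<int>\<^sub>n\<close> is
  \<^term>\<open>integer_mod_group n\<close> and \<open>\<int>\<^sup>d\<close> is \<^term>\<open>free_Abelian_group {..<d}\<close>, whose elements are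
  the finitely supported functions of type \<^typ>\<open>nat \<Rightarrow>\<^sub>0 int\<close> vanishing outside \<^term>\<open>{..<d}\<close>.
  Accordingly, \<open>\<real>\<^sup>d\<close> is modelled as a subspace of the real vector space \<^typ>\<open>nat \<Rightarrow>\<^sub>0 real\<close>.
\<close>

definition restricted_sumset :: "('a, 'm) monoid_scheme \<Rightarrow> 'a set \<Rightarrow> 'a set" where
  "restricted_sumset G X = {x \<otimes>\<^bsub>G\<^esub> y | x y. x \<in> X \<and> y \<in> X \<and> x \<noteq> y}"

definition is_gap :: "('a, 'm) monoid_scheme \<Rightarrow> nat \<Rightarrow> 'a set \<Rightarrow> bool" where
  "is_gap G d P \<longleftrightarrow>
     (\<exists>(a :: nat \<Rightarrow> 'a) (l :: nat \<Rightarrow> nat).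
        (\<forall>i\<in>{0..d}. a i \<in> carrier G) \<and>
        P = {a 0 \<otimes>\<^bsub>G\<^esub> finprod G (\<lambda>i. a i [^]\<^bsub>G\<^esub> w i) {1..d} | w :: nat \<Rightarrow> int.
               \<forall>i\<in>{1..d}. 0 \<le> w i \<and> w i < int (l i)})"

definition freiman_hom ::
  "('a, 'm) monoid_scheme \<Rightarrow> ('b, 'k) monoid_scheme \<Rightarrow> 'a set \<Rightarrow> 'b set \<Rightarrow> ('a \<Rightarrow> 'b) \<Rightarrow> bool" where
  "freiman_hom G H X Y \<phi> \<longleftrightarrow>
     \<phi> ` X \<subseteq> Y \<and>
     (\<forall>a\<^sub>1\<in>X. \<forall>a\<^sub>2\<in>X. \<forall>b\<^sub>1\<in>X. \<forall>b\<^sub>2\<in>X.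
        a\<^sub>1 \<otimes>\<^bsub>G\<^esub> b\<^sub>1 = a\<^sub>2 \<otimes>\<^bsub>G\<^esub> b\<^sub>2 \<longrightarrow> \<phi> a\<^sub>1 \<otimes>\<^bsub>H\<^esub> \<phi> b\<^sub>1 = \<phi> a\<^sub>2 \<otimes>\<^bsub>H\<^esub> \<phi> b\<^sub>2)"

definition freiman_iso ::
  "('a, 'm) monoid_scheme \<Rightarrow> ('b, 'k) monoid_scheme \<Rightarrow> 'a set \<Rightarrow> 'b set \<Rightarrow> ('a \<Rightarrow> 'b) \<Rightarrow> bool" where
  "freiman_iso G H X Y \<phi> \<longleftrightarrow>
     bij_betw \<phi> X Y \<and> freiman_hom G H X Y \<phi> \<and> freiman_hom H G Y X (inv_into X \<phi>)"

definition real_space :: "nat \<Rightarrow> (nat \<Rightarrow>\<^sub>0 real) set" where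
  "real_space d = {v. Poly_Mapping.keys v \<subseteq> {..<d}}"

definition real_vec :: "(nat \<Rightarrow>\<^sub>0 int) \<Rightarrow> (nat \<Rightarrow>\<^sub>0 real)" where
  "real_vec = Poly_Mapping.map real_of_int"

text \<open>
  An affine subspace is a translate \<open>p + V\<close> of a linear subspace \<open>V\<close>, and its dimension is
  \<^term>\<open>dim V\<close>. (The library notion of affine dimension is only available on Euclidean spaces, whose
  dimension is fixed by their type.)
\<close>

definition full_rank :: "nat \<Rightarrow> (nat \<Rightarrow>\<^sub>0 real) set \<Rightarrow> bool" where
  "full_rank d S \<longleftrightarrow>
     S \<subseteq> real_space d \<and>
     \<not> (\<exists>p V. p \<in> real_space d \<and> subspace V \<and> V \<subseteq> real_space d \<and> dim V < d \<and> S \<subseteq> (+) p ` V)"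

text \<open>
  For finite \<open>X\<close> the set below is bounded, so its supremum is its largest element if it is
  nonempty. It is empty if \<open>X\<close> is not Freiman isomorphic to any set of integer vectors; such an
  \<open>X\<close> gets the value \<open>0\<close>.
\<close>

definition freiman_dim :: "('a, 'm) monoid_scheme \<Rightarrow> 'a set \<Rightarrow> nat" where
  "freiman_dim G X =
     Sup {d. \<exists>S \<phi>. S \<subseteq> carrier (free_Abelian_group {..<d}) \<and> full_rank d (real_vec ` S) \<and>
                   freiman_iso G (free_Abelian_group {..<d}) X S \<phi>}"

definition robust_freiman_dim :: "('a, 'm) monoid_scheme \<Rightarrow> real \<Rightarrow> 'a set \<Rightarrow> nat \<Rightarrow> bool" where
  "robust_freiman_dim G \<epsilon> X d \<longleftrightarrow>
     freiman_dim G X \<ge> d \<and>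
     \<not> (\<exists>X'\<subseteq>X. real (card X') \<ge> (1 - \<epsilon>) * real (card X) \<and> freiman_dim G X' < d)"

end

theory Submission
  imports
    Defs
    "Jordan_Normal_Form.Determinant"
begin

text \<open>
  Let \<open>F\<close> be the union of two independent random subsets of \<open>X\<close>, of density about
  \<open>\<surd>(m log m) / (\<epsilon> k)\<close>. It captures every sum with at least \<open>\<epsilon>\<^sup>2 k\<^sup>2 / (16 m)\<close> representations, and
  since there are at most \<open>m\<close> sums, all but \<open>\<epsilon>\<^sup>2 k\<^sup>2 / 16\<close> pairs of \<open>X\<close> have their sum in \<open>F + F\<close>.
  Deleting at most \<open>\<epsilon> k / 2\<close> points leaves a set \<open>X'\<close> each of whose points \<open>t\<close> misses at most
  \<open>\<epsilon> k / 8\<close> of the sums \<open>x + t\<close>; by robustness \<open>X'\<close> has a full rank copy \<open>Y\<close> in some \<open>\<int>\<^sup>e\<close> with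
  \<open>e \<ge> d\<close>.

  Now choose a simplex \<open>t\<^sub>0, \<dots>, t\<^sub>e\<close> of maximal volume with vertices in \<open>Y\<close>, let \<open>c\<^sub>i\<close> be the barycentric
  coordinates, and give the pair \<open>(y, t\<^sub>i)\<close> the weight \<open>(1 + c\<^sub>i(y)) / 2\<close>, which is \<open>c\<^sub>i(s) / 2\<close> for
  \<open>s = y + t\<^sub>i\<close>. If \<open>s - t\<^sub>i \<in> Y\<close> for all \<open>i \<in> I\<close>, then replacing these \<open>t\<^sub>i\<close> by \<open>s - t\<^sub>i\<close> multiplies the
  volume by the absolute value of \<open>1 - \<Sum>\<^sub>I c\<^sub>i(s)\<close>, so maximality gives \<open>\<Sum>\<^sub>I c\<^sub>i(s) \<le> 2\<close>: every sum receives
  total weight at most \<open>1\<close>. As \<open>\<Sum>\<^sub>i (1 + c\<^sub>i(y)) / 2 = (e + 2) / 2\<close>, the sums \<open>y + t\<^sub>i\<close> number at least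
  \<open>(e + 2) / 2\<close> times the size of \<open>Y\<close>, less the weight of the missing pairs, which is at most \<open>1\<close> each.
\<close>

section \<open>Simplices of maximal volume\<close>

text \<open>The matrix determinant lemma. The block matrix with rows \<open>1, V\<close> and
  \<open>U, 1\<close>, where \<open>U\<close> is the column \<open>u\<close> and \<open>V\<close>
  the row \<open>-v\<close>, factors into block triangular matrices in two ways: clearing
  \<open>U\<close> leaves \<open>M\<close>, clearing \<open>V\<close> leaves \<open>S\<close>.
  Comparing determinants gives \<open>det M = det S\<close>.\<close>

lemma det_identity_plus_rank_one:
  fixes u v :: "nat \<Rightarrow> 'a :: idom"
  shows "det (mat n n (\<lambda>(i, j). (if i = j then 1 else 0) + u i * v j)) = 1 + (\<Sum>i<n. v i * u i)"
proof -
  define U where "U = mat n 1 (\<lambda>(i, j). u i)"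
  define V where "V = mat 1 n (\<lambda>(i, j). - v j)"
  define M where "M = mat n n (\<lambda>(i, j). (if i = j then 1 else 0) + u i * v j)"
  define S where "S = mat 1 1 (\<lambda>_. 1 + (\<Sum>i<n. v i * u i))"
  have [simp]: "U \<in> carrier_mat n 1" "V \<in> carrier_mat 1 n" "M \<in> carrier_mat n n" "S \<in> carrier_mat 1 1"
    by (simp_all add: U_def V_def M_def S_def)
  note unit = left_mult_one_mat[of V 1 n] left_mult_one_mat[of M n n] left_mult_one_mat[of U n 1]
    left_mult_one_mat[of S 1 1] right_mult_one_mat[of U n 1] right_mult_one_mat[of V 1 n]
    left_mult_zero_mat[of M n n 1] left_mult_zero_mat[of S 1 1 n] left_mult_zero_mat[of U n 1 1]
    right_mult_zero_mat[of "1\<^sub>m 1" 1 1 n] right_mult_zero_mat[of S 1 1 n]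
    right_add_zero_mat[of V 1 n] right_add_zero_mat[of U n 1]
    left_add_zero_mat[of V 1 n] left_add_zero_mat[of U n 1]
  have 1: "U * V + M = 1\<^sub>m n"
    by (rule eq_matI) (auto simp: U_def V_def M_def scalar_prod_def)
  have 2: "S + V * U = 1\<^sub>m 1"
    by (rule eq_matI)
      (auto simp: U_def V_def S_def scalar_prod_def sum_negf lessThan_atLeast0)
  have "four_block_mat (1\<^sub>m 1) (0\<^sub>m 1 n) U (1\<^sub>m n) * four_block_mat (1\<^sub>m 1) V (0\<^sub>m n 1) M
      = four_block_mat (1\<^sub>m 1) V U (1\<^sub>m n)"
    by (subst mult_four_block_mat[where ?n1.0 = 1 and ?n2.0 = n and ?nc1.0 = 1 and ?nc2.0 = n
          and ?nr1.0 = 1 and ?nr2.0 = n]) (simp_all add: 1 unit del: One_nat_def)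
  moreover have "four_block_mat (1\<^sub>m 1) V (0\<^sub>m n 1) (1\<^sub>m n) * four_block_mat S (0\<^sub>m 1 n) U (1\<^sub>m n)
      = four_block_mat (1\<^sub>m 1) V U (1\<^sub>m n)"
    by (subst mult_four_block_mat[where ?n1.0 = 1 and ?n2.0 = n and ?nc1.0 = 1 and ?nc2.0 = n
          and ?nr1.0 = 1 and ?nr2.0 = n]) (simp_all add: 2 unit del: One_nat_def)
  ultimately have "det (four_block_mat (1\<^sub>m 1) (0\<^sub>m 1 n) U (1\<^sub>m n))
        * det (four_block_mat (1\<^sub>m 1) V (0\<^sub>m n 1) M)
      = det (four_block_mat (1\<^sub>m 1) V (0\<^sub>m n 1) (1\<^sub>m n))
        * det (four_block_mat S (0\<^sub>m 1 n) U (1\<^sub>m n))"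
    by (subst (1 2) det_mult[symmetric, where n = "1 + n"]) (auto intro!: four_block_carrier_mat simp del: One_nat_def)
  then have "det M = det S"
    by (simp add: det_four_block_mat_upper_right_zero[where n = 1 and m = n]
        det_four_block_mat_lower_left_zero[where n = 1 and m = n] del: One_nat_def)
  also have "\<dots> = 1 + (\<Sum>i<n. v i * u i)"
    by (subst det_single) (simp_all add: S_def)
  finally show ?thesis
    by (simp add: M_def)
qed

lemma obtain_max_det_rows:
  fixes Y :: "real vec set"
  assumes fin: "finite Y" and Y: "Y \<subseteq> carrier_vec n"
    and \<rho>0: "\<And>i. i < n \<Longrightarrow> \<rho>0 i \<in> Y" and nz: "det (mat n n (\<lambda>(i, j). \<rho>0 i $ j)) \<noteq> 0"
  obtains \<rho> where "\<And>i. i < n \<Longrightarrow> \<rho> i \<in> Y" "det (mat n n (\<lambda>(i, j). \<rho> i $ j)) \<noteq> 0"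
    "\<And>\<rho>'. (\<And>i. i < n \<Longrightarrow> \<rho>' i \<in> Y) \<Longrightarrow>
       \<bar>det (mat n n (\<lambda>(i, j). \<rho>' i $ j))\<bar> \<le> \<bar>det (mat n n (\<lambda>(i, j). \<rho> i $ j))\<bar>"
proof -
  define D where "D \<rho> = \<bar>det (mat n n (\<lambda>(i, j). \<rho> i $ j))\<bar>" for \<rho> :: "nat \<Rightarrow> real vec"
  \<comment> \<open>Only the values of \<open>\<rho>\<close> below \<open>n\<close> affect
    \<open>D\<close>, so the maximum can be taken over the finite set of extensional
    functions.\<close>
  define \<Phi> where "\<Phi> = PiE {..<n} (\<lambda>_. Y)"
  have D_restrict: "D (restrict \<rho> {..<n}) = D \<rho>" for \<rho>
    unfolding D_def by (intro arg_cong[where f = abs] arg_cong[where f = det] eq_matI) auto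
  have in_Pi: "restrict \<rho> {..<n} \<in> \<Phi>" if "\<And>i. i < n \<Longrightarrow> \<rho> i \<in> Y" for \<rho>
    using that by (auto simp: \<Phi>_def)
  have "finite \<Phi>" using fin by (auto simp: \<Phi>_def intro: finite_PiE)
  moreover have "restrict \<rho>0 {..<n} \<in> \<Phi>" by (intro in_Pi \<rho>0)
  ultimately have "Max (D ` \<Phi>) \<in> D ` \<Phi>" by (intro Max_in) auto
  then obtain \<rho> where \<rho>: "\<rho> \<in> \<Phi>" and Max: "Max (D ` \<Phi>) = D \<rho>" by auto
  have max: "D \<rho>' \<le> D \<rho>" if "\<And>i. i < n \<Longrightarrow> \<rho>' i \<in> Y" for \<rho>'
  proof -
    have "restrict \<rho>' {..<n} \<in> \<Phi>" by (intro in_Pi that)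
    then have "D (restrict \<rho>' {..<n}) \<le> Max (D ` \<Phi>)"
      using \<open>finite \<Phi>\<close> by (intro Max_ge) auto
    then show ?thesis by (simp add: D_restrict Max)
  qed
  have "D \<rho> > 0" using max[of \<rho>0, OF \<rho>0] nz by (simp add: D_def)
  show thesis
    by (rule that[of \<rho>]) (use \<rho> \<open>D \<rho> > 0\<close> max in \<open>auto simp: \<Phi>_def D_def\<close>)
qed

text \<open>\<open>c v\<close> lists the coordinates of \<open>v\<close> in a basis from
  \<open>Y\<close> of maximal absolute determinant. Replacing the basis vectors with index in
  \<open>I\<close> by \<open>v - \<rho> i\<close> multiplies the determinant by plus or minus
  \<open>1 - (\<Sum>i\<in>I. c v i)\<close>, and maximality bounds the absolute value of this factor
  by 1.\<close>

lemma obtain_max_volume_basis: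
  fixes Y :: "real vec set"
  assumes fin: "finite Y" and Y: "Y \<subseteq> carrier_vec n"
    and \<rho>0: "\<And>i. i < n \<Longrightarrow> \<rho>0 i \<in> Y" and nz: "det (mat n n (\<lambda>(i, j). \<rho>0 i $ j)) \<noteq> 0"
  obtains \<rho> c where "\<And>i. i < n \<Longrightarrow> \<rho> i \<in> Y"
    "\<And>u v i. u \<in> carrier_vec n \<Longrightarrow> v \<in> carrier_vec n \<Longrightarrow> c (u + v) i = c u i + c v i"
    "\<And>i j. i < n \<Longrightarrow> j < n \<Longrightarrow> c (\<rho> i) j = (if i = j then 1 else 0 :: real)"
    "\<And>v j. v \<in> carrier_vec n \<Longrightarrow> j < n \<Longrightarrow> v $ j = (\<Sum>i<n. c v i * \<rho> i $ j)"
    "\<And>v I. v \<in> carrier_vec n \<Longrightarrow> I \<subseteq> {..<n} \<Longrightarrow> (\<And>i. i \<in> I \<Longrightarrow> v - \<rho> i \<in> Y) \<Longrightarrow> (\<Sum>i\<in>I. c v i) \<le> 2"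
proof -
  from obtain_max_det_rows[OF assms] obtain \<rho> where
    \<rho>: "\<And>i. i < n \<Longrightarrow> \<rho> i \<in> Y" and nz: "det (mat n n (\<lambda>(i, j). \<rho> i $ j)) \<noteq> 0" and
    max: "\<And>\<rho>'. (\<And>i. i < n \<Longrightarrow> \<rho>' i \<in> Y) \<Longrightarrow>
       \<bar>det (mat n n (\<lambda>(i, j). \<rho>' i $ j))\<bar> \<le> \<bar>det (mat n n (\<lambda>(i, j). \<rho> i $ j))\<bar>"
    by blast
  define M where "M = mat n n (\<lambda>(i, j). \<rho> i $ j)"
  have M [simp]: "M \<in> carrier_mat n n" by (simp add: M_def)
  from det_non_zero_imp_unit[OF M, of "()"] nz obtain W where
    W: "W \<in> carrier_mat n n" "W * M = 1\<^sub>m n" "M * W = 1\<^sub>m n"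
    by (auto simp: Units_def ring_mat_def M_def[symmetric])
  define c where "c v i = (\<Sum>j<n. v $ j * W $$ (j, i))" for v i
  have entry: "(A * B) $$ (i, j) = (\<Sum>l<n. A $$ (i, l) * B $$ (l, j))"
    if "A \<in> carrier_mat n n" "B \<in> carrier_mat n n" "i < n" "j < n" for A B :: "real mat" and i j
    using that by (simp add: scalar_prod_def lessThan_atLeast0)
  have repr: "v $ j = (\<Sum>i<n. c v i * \<rho> i $ j)" if "v \<in> carrier_vec n" "j < n" for v j
  proof -
    have "(\<Sum>i<n. c v i * \<rho> i $ j) = (\<Sum>i<n. \<Sum>l<n. v $ l * (W $$ (l, i) * M $$ (i, j)))"
      using \<open>j < n\<close> by (simp add: c_def M_def sum_distrib_right mult.assoc)
    also have "\<dots> = (\<Sum>l<n. v $ l * (W * M) $$ (l, j))"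
      by (subst sum.swap) (use W(1) \<open>j < n\<close> in \<open>simp add: entry sum_distrib_left\<close>)
    also have "\<dots> = v $ j"
      using \<open>j < n\<close> by (simp add: W(2) if_distrib sum.delta' cong: if_cong)
    finally show ?thesis by simp
  qed
  have "(\<Sum>i\<in>I. c v i) \<le> 2"
    if v: "v \<in> carrier_vec n" and I: "I \<subseteq> {..<n}" "\<And>i. i \<in> I \<Longrightarrow> v - \<rho> i \<in> Y" for v I
  proof -
    define \<rho>' where "\<rho>' i = (if i \<in> I then v - \<rho> i else \<rho> i)" for i
    define d where "d i = (if i \<in> I then -1 else 1 :: real)" for i
    \<comment> \<open>Row \<open>i\<close> of \<open>N * M\<close> is \<open>\<rho> i - v\<close>
      for \<open>i\<close> in \<open>I\<close> and \<open>\<rho> i\<close> otherwise;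
      \<open>S\<close> corrects the signs. \<open>N\<close> is a rank one change of the identity, so
      its determinant is explicit.\<close>
    define S where "S = mat n n (\<lambda>(i, j). if i = j then d i else 0)"
    define N where "N = mat n n (\<lambda>(i, j). (if i = j then 1 else 0) + (if i \<in> I then -1 else 0) * c v j)"
    have [simp]: "S \<in> carrier_mat n n" "N \<in> carrier_mat n n" by (simp_all add: S_def N_def)
    have "S * S = 1\<^sub>m n"
    proof (rule eq_matI)
      fix i j assume "i < dim_row (1\<^sub>m n :: real mat)" "j < dim_col (1\<^sub>m n :: real mat)"
      then have ij: "i < n" "j < n" by auto
      have "(S * S) $$ (i, j) = (\<Sum>l<n. if l = i then d i * (if i = j then d i else 0) else 0)"
        unfolding entry[OF \<open>S \<in> carrier_mat n n\<close> \<open>S \<in> carrier_mat n n\<close> ij]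
        by (rule sum.cong) (use ij in \<open>auto simp: S_def\<close>)
      with ij show "(S * S) $$ (i, j) = 1\<^sub>m n $$ (i, j)"
        by (simp add: d_def)
    qed (simp_all add: S_def)
    then have "det S * det S = 1"
      by (metis \<open>S \<in> carrier_mat n n\<close> det_mult det_one)
    then have S: "\<bar>det S\<bar> = 1"
      by (metis abs_mult_self_eq abs_one abs_square_eq_1 power2_eq_square)
    have N: "det N = 1 - (\<Sum>i\<in>I. c v i)"
      unfolding N_def det_identity_plus_rank_one
      using I(1) by (simp add: if_distrib sum.If_cases Int_absorb2 sum_negf Int_commute cong: if_cong)
    have NM: "(N * M) $$ (i, j) = (if i \<in> I then \<rho> i $ j - v $ j else \<rho> i $ j)"
      if "i < n" "j < n" for i j
    proof -
      have "(N * M) $$ (i, j)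
          = (\<Sum>l<n. (if i = l then \<rho> l $ j else 0) + (if i \<in> I then - (c v l * \<rho> l $ j) else 0))"
        using that by (simp add: entry) (intro sum.cong, auto simp: N_def M_def algebra_simps)
      also have "\<dots> = \<rho> i $ j + (if i \<in> I then - v $ j else 0)"
        using that by (simp add: sum.distrib repr[OF v \<open>j < n\<close>] sum_negf sum.delta)
      finally show ?thesis by simp
    qed
    have dim: "dim_vec (\<rho> i) = n" if "i < n" for i
      using \<rho>[OF that] Y by auto
    have "mat n n (\<lambda>(i, j). \<rho>' i $ j) = S * (N * M)"
    proof (rule eq_matI)
      fix i j assume "i < dim_row (S * (N * M))" "j < dim_col (S * (N * M))"
      then have ij: "i < n" "j < n" using M by (auto simp: S_def)
      have "(S * (N * M)) $$ (i, j) = (\<Sum>l<n. if l = i then d i * (N * M) $$ (i, j) else 0)"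
        unfolding entry[OF \<open>S \<in> carrier_mat n n\<close> mult_carrier_mat[OF \<open>N \<in> carrier_mat n n\<close> M] ij]
        by (rule sum.cong) (use ij in \<open>auto simp: S_def simp del: index_mult_mat(1)\<close>)
      with ij v show "mat n n (\<lambda>(i, j). \<rho>' i $ j) $$ (i, j) = (S * (N * M)) $$ (i, j)"
        by (auto simp: NM \<rho>'_def dim d_def simp del: index_mult_mat(1))
    qed (simp_all add: S_def M_def)
    then have "\<bar>det (mat n n (\<lambda>(i, j). \<rho>' i $ j))\<bar> = \<bar>1 - (\<Sum>i\<in>I. c v i)\<bar> * \<bar>det M\<bar>"
      by (simp add: det_mult[where n = n] mult_carrier_mat[where nr = n and n = n and nc = n] abs_mult S N)
    moreover have "\<bar>det (mat n n (\<lambda>(i, j). \<rho>' i $ j))\<bar> \<le> \<bar>det M\<bar>"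
      unfolding M_def by (rule max) (use \<rho> I(2) in \<open>auto simp: \<rho>'_def\<close>)
    ultimately have "\<bar>1 - (\<Sum>i\<in>I. c v i)\<bar> \<le> 1"
      using nz by (simp add: M_def[symmetric] mult_le_cancel_right1)
    then show ?thesis by linarith
  qed
  moreover have "c (u + v) i = c u i + c v i"
    if "u \<in> carrier_vec n" "v \<in> carrier_vec n" for u v i
    using that by (simp add: c_def algebra_simps sum.distrib)
  moreover have "c (\<rho> i) j = (if i = j then 1 else 0)" if "i < n" "j < n" for i j
  proof -
    have "c (\<rho> i) j = (M * W) $$ (i, j)"
      using that W(1) by (simp add: entry c_def) (simp add: M_def)
    with that show ?thesis by (simp add: W(3))
  qed
  ultimately show thesis
    using that[of \<rho> c] \<rho> repr by blast
qed

text \<open>Double counting of the pairs \<open>(y, \<rho> i)\<close> with weights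
  \<open>w y i\<close>. The constant coordinate \<open>j\<close> makes the coordinates of each
  \<open>y\<close> add up to 1, so the weights of \<open>y\<close> add up to
  \<open>(n + 1) / 2\<close>. Each sum collects weight at most 1, and each \<open>\<rho> i\<close>
  loses at most \<open>\<mu>\<close> to pairs outside \<open>R\<close>. Weights may be negative:
  only upper bounds on them enter.\<close>

lemma card_sumset_ge_of_nondegenerate:
  fixes Y :: "real vec set"
  assumes fin: "finite Y" and Y: "Y \<subseteq> carrier_vec n"
    and affine: "j < n" "\<And>y. y \<in> Y \<Longrightarrow> y $ j = 1"
    and \<rho>0: "\<And>i. i < n \<Longrightarrow> \<rho>0 i \<in> Y" and nz: "det (mat n n (\<lambda>(i, j). \<rho>0 i $ j)) \<noteq> 0"
    and miss: "\<And>t. t \<in> Y \<Longrightarrow> real (card {y \<in> Y. (y, t) \<notin> R}) \<le> \<mu>"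
  shows "real n * (real (card Y) / 2 - \<mu>) \<le> real (card {y + t | y t. y \<in> Y \<and> t \<in> Y \<and> (y, t) \<in> R})"
proof -
  from obtain_max_volume_basis[OF fin Y \<rho>0 nz] obtain \<rho> c where
    \<rho>: "\<And>i. i < n \<Longrightarrow> \<rho> i \<in> Y" and
    add: "\<And>u v i. u \<in> carrier_vec n \<Longrightarrow> v \<in> carrier_vec n \<Longrightarrow> c (u + v) i = c u i + c v i" and
    unit: "\<And>i j. i < n \<Longrightarrow> j < n \<Longrightarrow> c (\<rho> i) j = (if i = j then 1 else 0 :: real)" and
    repr: "\<And>v j. v \<in> carrier_vec n \<Longrightarrow> j < n \<Longrightarrow> v $ j = (\<Sum>i<n. c v i * \<rho> i $ j)" and
    le2: "\<And>v I. v \<in> carrier_vec n \<Longrightarrow> I \<subseteq> {..<n} \<Longrightarrow> (\<And>i. i \<in> I \<Longrightarrow> v - \<rho> i \<in> Y) \<Longrightarrow> (\<Sum>i\<in>I. c v i) \<le> 2"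
    by blast
  have Yc: "y \<in> carrier_vec n" if "y \<in> Y" for y using that Y by auto
  have \<rho>c: "\<rho> i \<in> carrier_vec n" if "i < n" for i using \<rho> Yc that by auto
  define w where "w y i = (1 + c y i) / 2" for y i
  define f where "f = (\<lambda>(i, y). y + \<rho> i)"
  define \<Gamma> where "\<Gamma> = (SIGMA i:{..<n}. {y \<in> Y. (y, \<rho> i) \<in> R})"
  have fin\<Gamma>: "finite \<Gamma>" using fin by (auto simp: \<Gamma>_def)
  have w: "w y i = c (y + \<rho> i) i / 2" if "y \<in> Y" "i < n" for y i
    using that by (simp add: w_def add Yc \<rho>c unit)
  have cancel: "y + \<rho> i - \<rho> i = y" if "y \<in> Y" "i < n" for y i
    using Yc[OF that(1)] \<rho>c[OF that(2)] by (intro eq_vecI) auto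
  have w_le: "w y i \<le> 1" if "y \<in> Y" "i < n" for y i
    using le2[of "y + \<rho> i" "{i}"] that by (simp add: w cancel Yc \<rho>c)
  have fibre: "(\<Sum>(i, y)\<in>{p \<in> \<Gamma>. f p = s}. w y i) \<le> 1" if "s \<in> f ` \<Gamma>" for s
  proof -
    define I where "I = {i. i < n \<and> (\<exists>y. (i, y) \<in> \<Gamma> \<and> y + \<rho> i = s)}"
    have s: "s \<in> carrier_vec n"
      using that by (auto simp: f_def \<Gamma>_def Yc \<rho>c)
    \<comment> \<open>In a fibre, \<open>i\<close> determines \<open>y = s - \<rho> i\<close>, and
      the weight depends only on \<open>s\<close> and \<open>i\<close>. So \<open>le2\<close> for
      the set \<open>I\<close> bounds the fibre, after halving.\<close>
    have "(\<Sum>(i, y)\<in>{p \<in> \<Gamma>. f p = s}. w y i) = (\<Sum>i\<in>I. c s i / 2)"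
      by (rule sum.reindex_bij_witness[of _ "\<lambda>i. (i, s - \<rho> i)" fst])
        (auto simp: I_def \<Gamma>_def f_def w cancel)
    also have "\<dots> \<le> 1"
      using le2[OF s, of I] by (force simp: I_def \<Gamma>_def cancel simp flip: sum_divide_distrib)
    finally show ?thesis .
  qed
  have total: "(\<Sum>i<n. w y i) = (real n + 1) / 2" if "y \<in> Y" for y
  proof -
    have "(\<Sum>i<n. c y i) = 1"
      using repr[OF Yc[OF that] affine(1)] affine(2) \<rho> that by simp
    then show ?thesis by (simp add: w_def sum.distrib flip: sum_divide_distrib)
  qed
  \<comment> \<open>A surplus of \<open>card Y / 2\<close> is given up here.\<close>
  have "real n * (real (card Y) / 2 - \<mu>) \<le> real (card Y) * ((real n + 1) / 2) - real n * \<mu>"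
    by (simp add: field_simps)
  also have "\<dots> = (\<Sum>i<n. (\<Sum>y\<in>Y. w y i) - \<mu>)"
    by (subst sum_subtractf, subst sum.swap) (simp add: total)
  also have "\<dots> \<le> (\<Sum>i<n. \<Sum>y | y \<in> Y \<and> (y, \<rho> i) \<in> R. w y i)"
  proof (rule sum_mono)
    fix i assume "i \<in> {..<n}"
    then have i: "i < n" by simp
    have "(\<Sum>y\<in>Y. w y i) = (\<Sum>y | y \<in> Y \<and> (y, \<rho> i) \<in> R. w y i) + (\<Sum>y | y \<in> Y \<and> (y, \<rho> i) \<notin> R. w y i)"
      by (subst sum.union_disjoint[symmetric]) (use fin in \<open>auto intro!: sum.cong\<close>)
    moreover have "(\<Sum>y | y \<in> Y \<and> (y, \<rho> i) \<notin> R. w y i) \<le> (\<Sum>y | y \<in> Y \<and> (y, \<rho> i) \<notin> R. 1)"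
      by (rule sum_mono) (simp add: w_le i)
    ultimately show "(\<Sum>y\<in>Y. w y i) - \<mu> \<le> (\<Sum>y | y \<in> Y \<and> (y, \<rho> i) \<in> R. w y i)"
      using miss[OF \<rho>[OF i]] by simp
  qed
  also have "\<dots> = (\<Sum>(i, y)\<in>\<Gamma>. w y i)"
    unfolding \<Gamma>_def by (rule sum.Sigma) (use fin in auto)
  also have "\<dots> = (\<Sum>s\<in>f ` \<Gamma>. \<Sum>(i, y)\<in>{p \<in> \<Gamma>. f p = s}. w y i)"
    by (rule sum.image_gen[OF fin\<Gamma>])
  also have "\<dots> \<le> real (card (f ` \<Gamma>))"
    using sum_mono[OF fibre, of "f ` \<Gamma>" "\<lambda>s. s"] by simp
  also have "\<dots> \<le> real (card {y + t | y t. y \<in> Y \<and> t \<in> Y \<and> (y, t) \<in> R})"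
  proof -
    have "{y + t | y t. y \<in> Y \<and> t \<in> Y \<and> (y, t) \<in> R} \<subseteq> (\<lambda>(y, t). y + t) ` (Y \<times> Y)" by auto
    then have "finite {y + t | y t. y \<in> Y \<and> t \<in> Y \<and> (y, t) \<in> R}"
      by (rule finite_subset) (use fin in simp)
    then show ?thesis
      by (intro of_nat_mono card_mono) (auto simp: f_def \<Gamma>_def intro: \<rho>)
  qed
  finally show ?thesis .
qed

section \<open>Partial sumsets and Freiman dimension\<close>

lemma lookup_real_vec: "Poly_Mapping.lookup (real_vec v) i = real_of_int (Poly_Mapping.lookup v i)"
  by (simp add: real_vec_def Poly_Mapping.map.rep_eq when_def)

lemma lookup_scaleR: "Poly_Mapping.lookup (r *\<^sub>R v) i = r *\<^sub>R Poly_Mapping.lookup v i"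
proof -
  have "{i. r *\<^sub>R Poly_Mapping.lookup v i \<noteq> 0} \<subseteq> Poly_Mapping.keys v"
    by (auto simp: in_keys_iff)
  then have "finite {i. r *\<^sub>R Poly_Mapping.lookup v i \<noteq> 0}"
    by (rule finite_subset) simp
  then show ?thesis by (simp add: scaleR_poly_mapping_def Abs_poly_mapping_inverse)
qed

lemma real_space_iff: "v \<in> real_space d \<longleftrightarrow> (\<forall>i\<ge>d. Poly_Mapping.lookup v i = 0)"
  by (auto simp: real_space_def in_keys_iff subset_iff) (meson not_less)

lemma subspace_real_space: "subspace (real_space d)"
  by (auto simp: subspace_def real_space_iff lookup_add lookup_scaleR)

text \<open>The extra coordinate 1 turns affine independence into linear independence, and it is the
  constant coordinate required by \<open>card_sumset_ge_of_nondegenerate\<close>.\<close>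

definition homogeneous_vec :: "nat \<Rightarrow> (nat \<Rightarrow>\<^sub>0 real) \<Rightarrow> real vec" where
  "homogeneous_vec d v = vec (Suc d) (\<lambda>j. if j < d then Poly_Mapping.lookup v j else 1)"

lemma homogeneous_vec_carrier [simp]: "homogeneous_vec d v \<in> carrier_vec (Suc d)"
  by (simp add: homogeneous_vec_def)

lemma homogeneous_vec_inj:
  assumes "u \<in> real_space d" "v \<in> real_space d" "homogeneous_vec d u = homogeneous_vec d v"
  shows "u = v"
proof (rule poly_mapping_eqI)
  fix j
  show "Poly_Mapping.lookup u j = Poly_Mapping.lookup v j"
  proof (cases "j < d")
    case True
    have "homogeneous_vec d u $ j = homogeneous_vec d v $ j" using assms(3) by simp
    with True show ?thesis by (simp add: homogeneous_vec_def)
  next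
    case False
    with assms(1,2) show ?thesis by (simp add: real_space_iff)
  qed
qed

text \<open>For \<open>p\<close> in \<open>S\<close>, the translate of \<open>span W\<close> by
  \<open>p\<close> contains \<open>S\<close>, so full rank yields \<open>d\<close> linearly
  independent differences \<open>b i\<close>. Then \<open>p\<close> and the points
  \<open>p + b i\<close> are affinely independent.\<close>

lemma full_rank_nondegenerate:
  assumes full: "full_rank d S" and "S \<noteq> {}"
  obtains \<rho> where "\<And>i. i < Suc d \<Longrightarrow> \<rho> i \<in> S"
    "det (mat (Suc d) (Suc d) (\<lambda>(i, j). homogeneous_vec d (\<rho> i) $ j)) \<noteq> 0"
proof -
  from \<open>S \<noteq> {}\<close> obtain p where p: "p \<in> S" by blast
  have S: "S \<subseteq> real_space d" using full by (simp add: full_rank_def)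
  define W where "W = (\<lambda>s. s - p) ` S"
  have W: "W \<subseteq> real_space d"
    unfolding W_def using S p by (auto intro!: subspace_diff[OF subspace_real_space])
  have "S \<subseteq> (+) p ` span W"
  proof
    fix s assume "s \<in> S"
    then have "s - p \<in> span W" by (auto simp: W_def intro: span_base)
    then show "s \<in> (+) p ` span W" by (rule rev_image_eqI) simp
  qed
  moreover have "span W \<subseteq> real_space d" by (rule span_minimal[OF W subspace_real_space])
  ultimately have "\<not> dim (span W) < d"
    using full S p by (auto simp: full_rank_def)
  then have "d \<le> dim W" by simp
  obtain B where B: "B \<subseteq> W" "independent B" "card B = dim W"
    by (rule basis_exists)
  obtain B' where B': "B' \<subseteq> B" "card B' = d" "finite B'"
    using obtain_subset_with_card_n \<open>d \<le> dim W\<close> B(3) by metis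
  obtain b where b: "bij_betw b {..<d} B'"
    using ex_bij_betw_nat_finite[OF B'(3)] B'(2) by (auto simp: lessThan_atLeast0)
  have bW: "b i \<in> W" if "i < d" for i
    using bij_betwE[OF b] that B'(1) B(1) by auto
  define \<rho> where "\<rho> i = (if i < d then p + b i else p)" for i
  define M where "M = mat (Suc d) (Suc d) (\<lambda>(i, j). homogeneous_vec d (\<rho> i) $ j)"
  have M: "M \<in> carrier_mat (Suc d) (Suc d)" by (simp add: M_def)
  have "\<rho> i \<in> S" for i
    using p bW[of i] by (auto simp: \<rho>_def W_def)
  moreover have "det M \<noteq> 0"
  proof
    \<comment> \<open>A kernel vector \<open>v\<close> of the transpose is a linear relation between
      the rows. Its last coordinate says that the coefficients add up to 0, so \<open>p\<close>
      cancels and a relation between the \<open>b i\<close> remains.\<close>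
    assume "det M = 0"
    then have "det (transpose_mat M) = 0" using det_transpose[OF M] by simp
    then obtain v where v: "v \<in> carrier_vec (Suc d)" "v \<noteq> 0\<^sub>v (Suc d)"
      "transpose_mat M *\<^sub>v v = 0\<^sub>v (Suc d)"
      using det_0_iff_vec_prod_zero[of "transpose_mat M" "Suc d"] M by auto
    have eq: "(\<Sum>i<Suc d. v $ i * homogeneous_vec d (\<rho> i) $ j) = 0" if "j < Suc d" for j
    proof -
      have "(\<Sum>i<Suc d. v $ i * homogeneous_vec d (\<rho> i) $ j) = (transpose_mat M *\<^sub>v v) $ j"
        using that v(1) M
        by (simp add: scalar_prod_def lessThan_atLeast0 M_def mult.commute del: sum.lessThan_Suc)
      then show ?thesis using that by (simp add: v(3))
    qed
    have sum0: "(\<Sum>i<Suc d. v $ i) = 0"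
      using eq[of d] by (simp add: homogeneous_vec_def)
    have "(\<Sum>i<d. v $ i *\<^sub>R b i) = 0"
    proof (rule poly_mapping_eqI)
      fix j
      show "Poly_Mapping.lookup (\<Sum>i<d. v $ i *\<^sub>R b i) j = Poly_Mapping.lookup 0 j"
      proof (cases "j < d")
        case True
        have "0 = (\<Sum>i<Suc d. v $ i * Poly_Mapping.lookup (\<rho> i) j)"
          using eq[of j] True by (simp add: homogeneous_vec_def)
        also have "\<dots> = (\<Sum>i<Suc d. v $ i) * Poly_Mapping.lookup p j + (\<Sum>i<d. v $ i * Poly_Mapping.lookup (b i) j)"
          by (simp add: \<rho>_def lookup_add algebra_simps sum.distrib sum_distrib_left)
        finally show ?thesis
          by (simp add: sum0 lookup_sum lookup_scaleR del: sum.lessThan_Suc)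
      next
        case False
        have "Poly_Mapping.lookup (b i) j = 0" if "i < d" for i
          using bW[OF that] W False by (auto simp: real_space_iff)
        then show ?thesis by (simp add: lookup_sum lookup_scaleR)
      qed
    qed
    moreover have "(\<Sum>i<d. v $ i *\<^sub>R b i) = (\<Sum>x\<in>B'. v $ inv_into {..<d} b x *\<^sub>R x)"
      using b by (subst sum.reindex_bij_betw[OF b, symmetric])
        (auto intro!: sum.cong simp: bij_betw_def inv_into_f_f)
    ultimately have "v $ inv_into {..<d} b x = 0" if "x \<in> B'" for x
      using independentD[OF B(2) B'(3,1) _ that, of "\<lambda>x. v $ inv_into {..<d} b x"] by simp
    then have v0: "v $ i = 0" if "i < d" for i
      using that b by (metis bij_betw_def bij_betwE inv_into_f_f lessThan_iff)
    then have "v $ d = 0" using sum0 by simp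
    with v0 have "v = 0\<^sub>v (Suc d)"
      using v(1) by (intro eq_vecI) (auto simp: less_Suc_eq)
    with v(2) show False by simp
  qed
  ultimately show thesis using that[of \<rho>] by (simp add: M_def)
qed

text \<open>If every dimension in the set behind \<open>freiman_dim\<close> were at most
  \<open>d - 1\<close>, so would be its supremum. The condition \<open>d > 0\<close> excludes the
  default value 0 of the empty supremum.\<close>

lemma freiman_dim_ge_imp:
  assumes "d \<le> freiman_dim G X" "d > 0"
  obtains e S \<phi> where "d \<le> e" "S \<subseteq> carrier (free_Abelian_group {..<e})" "full_rank e (real_vec ` S)"
    "freiman_iso G (free_Abelian_group {..<e}) X S \<phi>"
proof -
  define A where "A = {d. \<exists>S \<phi>. S \<subseteq> carrier (free_Abelian_group {..<d}) \<and> full_rank d (real_vec ` S) \<and>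
                   freiman_iso G (free_Abelian_group {..<d}) X S \<phi>}"
  have *: "d \<le> Sup A" using assms(1) by (simp add: freiman_dim_def A_def)
  have "\<exists>e\<in>A. d \<le> e"
  proof (rule ccontr)
    assume "\<not> (\<exists>e\<in>A. d \<le> e)"
    then have "\<forall>e\<in>A. e \<le> d - 1" by auto
    moreover have "A \<noteq> {}" using * assms(2) by (auto simp: Sup_nat_def)
    ultimately have "Sup A \<le> d - 1" by (meson cSup_least)
    with * assms(2) show False by simp
  qed
  then show thesis using that by (auto simp: A_def)
qed

text \<open>Carries the geometric bound back to \<open>G\<close>. Since \<open>\<phi>\<close> is a
  Freiman homomorphism, a sum in \<open>G\<close> determines the sum of the images, so
  \<open>G\<close> has at least as many sums along \<open>R\<close> as the copy has along the image
  of \<open>R\<close>.\<close>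

lemma card_partial_sumset_ge:
  assumes fin: "finite X" and "X \<noteq> {}" and dim: "d \<le> freiman_dim G X" "d > 0"
    and miss: "\<And>t. t \<in> X \<Longrightarrow> real (card {x \<in> X. (x, t) \<notin> R}) \<le> \<mu>"
    and \<mu>: "\<mu> \<le> real (card X) / 2"
  shows "real (d + 1) * (real (card X) / 2 - \<mu>) \<le> real (card {x \<otimes>\<^bsub>G\<^esub> t | x t. x \<in> X \<and> t \<in> X \<and> (x, t) \<in> R})"
proof -
  from dim obtain e S \<phi> where "d \<le> e" and S: "S \<subseteq> carrier (free_Abelian_group {..<e})"
    and full: "full_rank e (real_vec ` S)" and iso: "freiman_iso G (free_Abelian_group {..<e}) X S \<phi>"
    by (rule freiman_dim_ge_imp)
  have \<phi>: "inj_on \<phi> X" "\<phi> ` X = S" using iso by (auto simp: freiman_iso_def bij_betw_def)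
  have hom: "\<phi> x + \<phi> t = \<phi> x' + \<phi> t'"
    if "x \<in> X" "t \<in> X" "x' \<in> X" "t' \<in> X" "x \<otimes>\<^bsub>G\<^esub> t = x' \<otimes>\<^bsub>G\<^esub> t'" for x t x' t'
  proof -
    have "freiman_hom G (free_Abelian_group {..<e}) X S \<phi>" using iso by (simp add: freiman_iso_def)
    then have "\<phi> x \<otimes>\<^bsub>free_Abelian_group {..<e}\<^esub> \<phi> t = \<phi> x' \<otimes>\<^bsub>free_Abelian_group {..<e}\<^esub> \<phi> t'"
      using that unfolding freiman_hom_def by blast
    then show ?thesis by simp
  qed
  define h where "h x = homogeneous_vec e (real_vec (\<phi> x))" for x
  have h_inj: "inj_on h X"
  proof (rule inj_onI)
    fix x y assume xy: "x \<in> X" "y \<in> X" "h x = h y"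
    then have eq: "real_vec (\<phi> x) = real_vec (\<phi> y)"
      using full \<phi>(2) by (intro homogeneous_vec_inj[of _ e]) (auto simp: full_rank_def h_def)
    have "\<phi> x = \<phi> y"
    proof (rule poly_mapping_eqI)
      fix j
      have "Poly_Mapping.lookup (real_vec (\<phi> x)) j = Poly_Mapping.lookup (real_vec (\<phi> y)) j"
        by (simp add: eq)
      then show "Poly_Mapping.lookup (\<phi> x) j = Poly_Mapping.lookup (\<phi> y) j"
        by (simp add: lookup_real_vec)
    qed
    then show "x = y" using \<phi>(1) xy by (auto dest: inj_onD)
  qed
  have h_hom: "h x + h t = h x' + h t'"
    if "x \<in> X" "t \<in> X" "x' \<in> X" "t' \<in> X" "x \<otimes>\<^bsub>G\<^esub> t = x' \<otimes>\<^bsub>G\<^esub> t'" for x t x' t'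
  proof -
    have "Poly_Mapping.lookup (\<phi> x) j + Poly_Mapping.lookup (\<phi> t) j = Poly_Mapping.lookup (\<phi> x') j + Poly_Mapping.lookup (\<phi> t') j" for j
      using hom[OF that] by (metis lookup_add)
    then have "real_of_int (Poly_Mapping.lookup (\<phi> x) j) + Poly_Mapping.lookup (\<phi> t) j = real_of_int (Poly_Mapping.lookup (\<phi> x') j) + Poly_Mapping.lookup (\<phi> t') j" for j
      by (metis of_int_add)
    then show ?thesis
      by (intro eq_vecI) (auto simp: h_def homogeneous_vec_def lookup_real_vec)
  qed
  define Y where "Y = h ` X"
  have cardY: "card Y = card X" using h_inj by (simp add: Y_def card_image)
  define Q where "Q = {(h x, h t) | x t. x \<in> X \<and> t \<in> X \<and> (x, t) \<in> R}"
  have Q: "(h x, h t) \<in> Q \<longleftrightarrow> (x, t) \<in> R" if "x \<in> X" "t \<in> X" for x t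
    using that h_inj by (auto simp: Q_def dest: inj_onD)
  have "real_vec ` S \<noteq> {}" using \<phi>(2) \<open>X \<noteq> {}\<close> by auto
  from full_rank_nondegenerate[OF full this] obtain \<rho> where
    \<rho>: "\<And>i. i < Suc e \<Longrightarrow> \<rho> i \<in> real_vec ` S" and
    nz: "det (mat (Suc e) (Suc e) (\<lambda>(i, j). homogeneous_vec e (\<rho> i) $ j)) \<noteq> 0"
    by blast
  have "real (Suc e) * (real (card Y) / 2 - \<mu>)
      \<le> real (card {y + t | y t. y \<in> Y \<and> t \<in> Y \<and> (y, t) \<in> Q})"
  proof (rule card_sumset_ge_of_nondegenerate[where j = e and ?\<rho>0.0 = "\<lambda>i. homogeneous_vec e (\<rho> i)"])
    show "homogeneous_vec e (\<rho> i) \<in> Y" if "i < Suc e" for i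
      using \<rho>[OF that] \<phi>(2) by (auto simp: Y_def h_def)
    show "real (card {y \<in> Y. (y, t) \<notin> Q}) \<le> \<mu>" if "t \<in> Y" for t
    proof -
      from that obtain u where u: "u \<in> X" "t = h u" by (auto simp: Y_def)
      have "{y \<in> Y. (y, t) \<notin> Q} = h ` {x \<in> X. (x, u) \<notin> R}"
        using u by (auto simp: Y_def Q)
      also have "card \<dots> = card {x \<in> X. (x, u) \<notin> R}"
        by (rule card_image) (use h_inj in \<open>auto intro: inj_on_subset\<close>)
      finally show ?thesis using miss[OF u(1)] by simp
    qed
  qed (use nz fin in \<open>auto simp: Y_def h_def homogeneous_vec_def[of e "real_vec _"]\<close>)
  also have "\<dots> \<le> real (card {x \<otimes>\<^bsub>G\<^esub> t | x t. x \<in> X \<and> t \<in> X \<and> (x, t) \<in> R})"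
  proof (intro of_nat_mono surj_card_le)
    have "{x \<otimes>\<^bsub>G\<^esub> t | x t. x \<in> X \<and> t \<in> X \<and> (x, t) \<in> R} \<subseteq> (\<lambda>(x, t). x \<otimes>\<^bsub>G\<^esub> t) ` (X \<times> X)" by auto
    then show "finite {x \<otimes>\<^bsub>G\<^esub> t | x t. x \<in> X \<and> t \<in> X \<and> (x, t) \<in> R}"
      by (rule finite_subset) (use fin in simp)
    \<comment> \<open>The choice of the representation of \<open>s\<close> is immaterial by
      \<open>h_hom\<close>.\<close>
    define g where "g s = (SOME z. \<exists>x\<in>X. \<exists>t\<in>X. s = x \<otimes>\<^bsub>G\<^esub> t \<and> z = h x + h t)" for s
    have g: "g (x \<otimes>\<^bsub>G\<^esub> t) = h x + h t" if "x \<in> X" "t \<in> X" for x t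
      unfolding g_def
    proof (rule some_equality)
      show "\<exists>x'\<in>X. \<exists>t'\<in>X. x \<otimes>\<^bsub>G\<^esub> t = x' \<otimes>\<^bsub>G\<^esub> t' \<and> h x + h t = h x' + h t'" using that by blast
    next
      fix z assume "\<exists>x'\<in>X. \<exists>t'\<in>X. x \<otimes>\<^bsub>G\<^esub> t = x' \<otimes>\<^bsub>G\<^esub> t' \<and> z = h x' + h t'"
      then obtain x' t' where *: "x' \<in> X" "t' \<in> X" "x \<otimes>\<^bsub>G\<^esub> t = x' \<otimes>\<^bsub>G\<^esub> t'" "z = h x' + h t'" by blast
      show "z = h x + h t" unfolding *(4) by (rule h_hom[OF that *(1,2,3), symmetric])
    qed
    show "{y + t | y t. y \<in> Y \<and> t \<in> Y \<and> (y, t) \<in> Q}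
        \<subseteq> g ` {x \<otimes>\<^bsub>G\<^esub> t | x t. x \<in> X \<and> t \<in> X \<and> (x, t) \<in> R}"
    proof
      fix z assume "z \<in> {y + t | y t. y \<in> Y \<and> t \<in> Y \<and> (y, t) \<in> Q}"
      then obtain x t where xt: "x \<in> X" "t \<in> X" "(x, t) \<in> R" "z = h x + h t"
        by (auto simp: Y_def Q)
      then have "z = g (x \<otimes>\<^bsub>G\<^esub> t)" by (simp add: g)
      with xt show "z \<in> g ` {x \<otimes>\<^bsub>G\<^esub> t | x t. x \<in> X \<and> t \<in> X \<and> (x, t) \<in> R}" by blast
    qed
  qed
  finally have *: "real (Suc e) * (real (card X) / 2 - \<mu>) \<le> \<dots>" by (simp add: cardY)
  \<comment> \<open>The bound on \<open>\<mu>\<close> makes the second factor nonnegative, so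
    \<open>e\<close> may be lowered to \<open>d\<close>.\<close>
  have "real (d + 1) * (real (card X) / 2 - \<mu>) \<le> real (Suc e) * (real (card X) / 2 - \<mu>)"
    using \<open>d \<le> e\<close> \<mu> by (intro mult_right_mono) auto
  with * show ?thesis by linarith
qed

section \<open>Fingerprints\<close>

text \<open>Expand the right-hand product, taking \<open>p * g x\<close> for \<open>x\<close> in
  \<open>A\<close> and \<open>1 - p\<close> elsewhere. This is the expectation of a product over a
  random subset of density \<open>p\<close>.\<close>

lemma sum_Pow_Bernoulli_prod:
  fixes p :: real and g :: "'a \<Rightarrow> real"
  assumes "finite X"
  shows "(\<Sum>A\<in>Pow X. p ^ card A * (1 - p) ^ card (X - A) * (\<Prod>x\<in>A. g x)) = (\<Prod>x\<in>X. p * g x + (1 - p))"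
  by (subst prod_add[OF assms]) (auto intro!: sum.cong simp: prod.distrib mult_ac)

text \<open>The probability of avoiding \<open>Y\<close>: the indicator of disjointness is a product
  of indicators over the points of \<open>A\<close>.\<close>

lemma sum_Pow_Bernoulli_disjoint:
  fixes p :: real
  assumes X: "finite X" and Y: "Y \<subseteq> X"
  shows "(\<Sum>A\<in>Pow X. p ^ card A * (1 - p) ^ card (X - A) * of_bool (A \<inter> Y = {})) = (1 - p) ^ card Y"
proof -
  have "(\<Prod>x\<in>A. of_bool (x \<notin> Y)) = (of_bool (A \<inter> Y = {}) :: real)" if "A \<in> Pow X" for A
  proof (cases "A \<inter> Y = {}")
    case True
    then show ?thesis by (auto intro!: prod.neutral)
  next
    case False
    then show ?thesis using that finite_subset[OF _ X, of A] by (auto simp: prod_zero_iff)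
  qed
  then have "(\<Sum>A\<in>Pow X. p ^ card A * (1 - p) ^ card (X - A) * of_bool (A \<inter> Y = {}))
      = (\<Prod>x\<in>X. p * of_bool (x \<notin> Y) + (1 - p))"
    by (subst sum_Pow_Bernoulli_prod[OF X, symmetric]) (auto intro!: sum.cong)
  also have "\<dots> = (\<Prod>x\<in>Y. 1 - p)"
    by (rule prod.mono_neutral_cong_right) (use X Y in auto)
  finally show ?thesis by simp
qed

lemma sum_Pow_Bernoulli:
  fixes p :: real
  assumes "finite X"
  shows "(\<Sum>A\<in>Pow X. p ^ card A * (1 - p) ^ card (X - A)) = 1"
  using sum_Pow_Bernoulli_disjoint[OF assms, of "{}"] by simp

lemma sum_Pow_Bernoulli_card:
  fixes p :: real
  assumes "finite X"
  shows "(\<Sum>A\<in>Pow X. p ^ card A * (1 - p) ^ card (X - A) * real (card A)) = p * real (card X)"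
proof -
  define w where "w A = p ^ card A * (1 - p) ^ card (X - A)" for A
  have card: "real (card A) = (\<Sum>x\<in>X. 1 - of_bool (A \<inter> {x} = {}))" if "A \<in> Pow X" for A
  proof -
    have "(\<Sum>x\<in>X. 1 - of_bool (A \<inter> {x} = {})) = (\<Sum>x\<in>A. 1 :: real)"
      by (rule sum.mono_neutral_cong_right) (use assms that in auto)
    then show ?thesis by simp
  qed
  have "(\<Sum>A\<in>Pow X. w A * real (card A)) = (\<Sum>A\<in>Pow X. \<Sum>x\<in>X. w A - w A * of_bool (A \<inter> {x} = {}))"
    by (intro sum.cong refl) (simp add: card sum_distrib_left algebra_simps)
  also have "\<dots> = (\<Sum>x\<in>X. (\<Sum>A\<in>Pow X. w A) - (\<Sum>A\<in>Pow X. w A * of_bool (A \<inter> {x} = {})))"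
    by (subst sum.swap) (simp only: sum_subtractf)
  also have "\<dots> = (\<Sum>x\<in>X. p)"
    using assms unfolding w_def
    by (intro sum.cong refl) (subst sum_Pow_Bernoulli sum_Pow_Bernoulli_disjoint, auto)+
  finally show ?thesis by (simp add: w_def)
qed

text \<open>
  With two independent random sets \<open>A\<close> and \<open>B\<close>, the events \<open>x \<in> A \<and> q s x \<in> B\<close> for \<open>x \<in> R s\<close> are
  independent even when \<open>R s\<close> and its image under \<open>q s\<close> overlap.
\<close>

lemma Bernoulli_pair_hitting:
  fixes p :: real and X :: "'a set" and R :: "'s \<Rightarrow> 'a set"
  assumes X: "finite X" "X \<noteq> {}" and p: "0 < p" "p \<le> 1"
    and S: "finite S" and R: "\<And>s. s \<in> S \<Longrightarrow> R s \<subseteq> X"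
    and q: "\<And>s. s \<in> S \<Longrightarrow> inj_on (q s) (R s)" "\<And>s. s \<in> S \<Longrightarrow> q s ` R s \<subseteq> X"
    and small: "(\<Sum>s\<in>S. (1 - p\<^sup>2) ^ card (R s)) < 1 / 2"
  obtains A B where "A \<subseteq> X" "B \<subseteq> X" "real (card A) + real (card B) \<le> 4 * p * real (card X)"
    "\<And>s. s \<in> S \<Longrightarrow> \<exists>x\<in>R s. x \<in> A \<and> q s x \<in> B"
proof -
  define w where "w A = p ^ card A * (1 - p) ^ card (X - A)" for A
  have w_nonneg: "w A \<ge> 0" for A using p by (simp add: w_def)
  note w_sum = sum_Pow_Bernoulli[OF X(1), of p, folded w_def]
    sum_Pow_Bernoulli_card[OF X(1), of p, folded w_def]
    sum_Pow_Bernoulli_disjoint[OF X(1), of _ p, folded w_def]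
  define K where "K = 4 * p * real (card X)"
  have K: "K > 0" using X p by (simp add: K_def card_gt_0_iff)
  define miss where "miss A B s = (of_bool (B \<inter> q s ` (A \<inter> R s) = {}) :: real)" for A B s
  \<comment> \<open>The expected total size is \<open>2 * p * card X\<close>, so the first term
    averages 1/2 and the misses average less than 1/2. A pair with \<open>\<Phi> A B < 1\<close>
    therefore exists; it meets the size bound and misses nothing.\<close>
  define \<Phi> where "\<Phi> A B = (real (card A) + real (card B)) / K + (\<Sum>s\<in>S. miss A B s)" for A B
  \<comment> \<open>Averaging over \<open>B\<close> first leaves a factor \<open>1 - p\<close> for
    each point of \<open>A \<inter> R s\<close>. Averaging over \<open>A\<close> then gives
    \<open>p * (1 - p) + (1 - p) = 1 - p\<^sup>2\<close> per point of \<open>R s\<close>.\<close>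
  have miss: "(\<Sum>A\<in>Pow X. w A * (\<Sum>B\<in>Pow X. w B * miss A B s)) = (1 - p\<^sup>2) ^ card (R s)" if s: "s \<in> S" for s
  proof -
    have "(\<Sum>B\<in>Pow X. w B * miss A B s) = (\<Prod>x\<in>A. if x \<in> R s then 1 - p else 1)" if "A \<in> Pow X" for A
    proof -
      have "finite A" using that X(1) finite_subset by auto
      have "(\<Sum>B\<in>Pow X. w B * miss A B s) = (1 - p) ^ card (q s ` (A \<inter> R s))"
        unfolding miss_def using q(2)[OF s] by (intro w_sum) auto
      also have "card (q s ` (A \<inter> R s)) = card (A \<inter> R s)"
        by (intro card_image inj_on_subset[OF q(1)[OF s]]) auto
      finally show ?thesis using \<open>finite A\<close> by (simp add: prod.If_cases Int_def)
    qed
    then have "(\<Sum>A\<in>Pow X. w A * (\<Sum>B\<in>Pow X. w B * miss A B s))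
        = (\<Prod>x\<in>X. p * (if x \<in> R s then 1 - p else 1) + (1 - p))"
      by (subst sum_Pow_Bernoulli_prod[OF X(1), symmetric]) (simp add: w_def)
    also have "\<dots> = (\<Prod>x\<in>R s. 1 - p\<^sup>2)"
      by (rule prod.mono_neutral_cong_right)
        (use X(1) R[OF s] in \<open>auto simp: algebra_simps power2_eq_square\<close>)
    finally show ?thesis by simp
  qed
  have "(\<Sum>A\<in>Pow X. w A * (\<Sum>B\<in>Pow X. w B * \<Phi> A B))
      = (\<Sum>A\<in>Pow X. w A * (real (card A) / K + p * real (card X) / K + (\<Sum>s\<in>S. \<Sum>B\<in>Pow X. w B * miss A B s)))"
  proof (intro sum.cong refl arg_cong2[where f = "(*)"])
    fix A
    have "(\<Sum>B\<in>Pow X. w B * \<Phi> A B) = (\<Sum>B\<in>Pow X. w B) * (real (card A) / K)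
        + (\<Sum>B\<in>Pow X. w B * real (card B)) / K + (\<Sum>B\<in>Pow X. \<Sum>s\<in>S. w B * miss A B s)"
      by (simp add: \<Phi>_def algebra_simps add_divide_distrib sum.distrib sum_distrib_left
          sum_distrib_right sum_divide_distrib)
    then show "(\<Sum>B\<in>Pow X. w B * \<Phi> A B)
        = real (card A) / K + p * real (card X) / K + (\<Sum>s\<in>S. \<Sum>B\<in>Pow X. w B * miss A B s)"
      by (simp only: w_sum sum.swap[of _ S] mult_1)
  qed
  also have "\<dots> = (\<Sum>A\<in>Pow X. w A * real (card A)) / K + (\<Sum>A\<in>Pow X. w A) * (p * real (card X) / K)
      + (\<Sum>A\<in>Pow X. \<Sum>s\<in>S. w A * (\<Sum>B\<in>Pow X. w B * miss A B s))"
    by (simp only: distrib_left sum.distrib sum_divide_distrib sum_distrib_right sum_distrib_left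
        times_divide_eq_right)
  also have "\<dots> = 1 / 2 + (\<Sum>s\<in>S. (1 - p\<^sup>2) ^ card (R s))"
    using K p by (subst sum.swap) (auto simp: w_sum miss K_def divide_simps card_gt_0_iff zero_less_mult_iff cong: sum.cong)
  also have "\<dots> < 1" using small by simp
  also have "1 = (\<Sum>A\<in>Pow X. w A * (\<Sum>B\<in>Pow X. w B * 1))"
    by (simp add: w_sum)
  finally have *: "(\<Sum>A\<in>Pow X. w A * (\<Sum>B\<in>Pow X. w B * \<Phi> A B)) < (\<Sum>A\<in>Pow X. w A * (\<Sum>B\<in>Pow X. w B * 1))" .
  have "\<exists>A\<in>Pow X. \<exists>B\<in>Pow X. \<Phi> A B < 1"
  proof (rule ccontr)
    assume "\<not> ?thesis"
    then have "(\<Sum>A\<in>Pow X. w A * (\<Sum>B\<in>Pow X. w B * 1)) \<le> (\<Sum>A\<in>Pow X. w A * (\<Sum>B\<in>Pow X. w B * \<Phi> A B))"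
      by (intro sum_mono mult_left_mono w_nonneg) (auto simp: not_less)
    with * show False by simp
  qed
  then obtain A B where AB: "A \<subseteq> X" "B \<subseteq> X" "\<Phi> A B < 1" by auto
  have miss_nonneg: "miss A B s \<ge> 0" for s by (simp add: miss_def)
  show thesis
  proof (rule that[OF AB(1,2)])
    have "(real (card A) + real (card B)) / K \<le> \<Phi> A B"
      unfolding \<Phi>_def using sum_nonneg[of S "miss A B"] miss_nonneg by simp
    with AB(3) have "(real (card A) + real (card B)) / K \<le> 1" by simp
    with K show "real (card A) + real (card B) \<le> 4 * p * real (card X)"
      by (simp add: K_def divide_le_eq)
    show "\<exists>x\<in>R s. x \<in> A \<and> q s x \<in> B" if "s \<in> S" for s
    proof -
      have "miss A B s \<le> (\<Sum>s\<in>S. miss A B s)"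
        by (rule member_le_sum) (use that S miss_nonneg in auto)
      also have "\<dots> \<le> \<Phi> A B" using K by (simp add: \<Phi>_def)
      \<comment> \<open>An indicator below 1 is 0.\<close>
      finally have "miss A B s < 1" using AB(3) by simp
      then show ?thesis by (auto simp: miss_def split: if_splits)
    qed
  qed
qed

section \<open>Capturing the popular sums\<close>

lemma finite_restricted_sumset:
  assumes "finite X"
  shows "finite (restricted_sumset G X)"
proof -
  have "restricted_sumset G X \<subseteq> (\<lambda>(x, y). x \<otimes>\<^bsub>G\<^esub> y) ` (X \<times> X)"
    by (auto simp: restricted_sumset_def)
  then show ?thesis by (rule finite_subset) (use assms in simp)
qed

text \<open>Sums with at least \<open>\<tau>\<close> representations are captured with failure
  probability at most \<open>1 / m ^ 4\<close> each, hence all at once. The remaining sums, at most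
  \<open>m\<close> of them, account for at most \<open>m * \<tau>\<close> pairs.\<close>

lemma exists_fingerprint:
  fixes G (structure)
  assumes G: "group G" and XG: "X \<subseteq> carrier G" and X: "finite X" "X \<noteq> {}"
    and m: "real (card (restricted_sumset G X)) \<le> m" "m \<ge> 2" and \<epsilon>: "0 < \<epsilon>"
  obtains F where "F \<subseteq> X" "real (card F) \<le> 32 * inverse \<epsilon> * sqrt (m * ln m)"
    "real (card {(x, y) \<in> X \<times> X. x \<noteq> y \<and> x \<otimes> y \<notin> restricted_sumset G F}) \<le> \<epsilon>\<^sup>2 * (real (card X))\<^sup>2 / 16"
proof -
  interpret group G by fact
  define k where "k = real (card X)"
  have k: "k > 0" using X by (simp add: k_def card_gt_0_iff)
  have lnm: "ln m > 0" using m(2) by simp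
  \<comment> \<open>The factor 8 gives \<open>p\<^sup>2 * \<tau> = 4 * ln m\<close> below; the size
    bound \<open>4 * p * k\<close> then produces the constant 32.\<close>
  define p where "p = 8 * sqrt (m * ln m) / (\<epsilon> * k)"
  have p0: "p > 0" using lnm m(2) \<epsilon> k by (simp add: p_def)
  have L: "32 * inverse \<epsilon> * sqrt (m * ln m) = 4 * p * k"
    using k \<epsilon> by (simp add: p_def field_simps)
  show thesis
  proof (cases "p \<le> 1")
    \<comment> \<open>Here the size bound exceeds \<open>card X\<close>, so \<open>F = X\<close>
      serves.\<close>
    case False
    then have "k \<le> 4 * p * k" using k by simp
    moreover have "{(x, y) \<in> X \<times> X. x \<noteq> y \<and> x \<otimes> y \<notin> restricted_sumset G X} = {}"
      by (auto simp: restricted_sumset_def)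
    ultimately show thesis
      using that[of X] unfolding L by (simp only: k_def card.empty) simp
  next
    case True
    define T where "T = restricted_sumset G X"
    define R where "R s = {x \<in> X. \<exists>y\<in>X. x \<noteq> y \<and> x \<otimes> y = s}" for s
    define q where "q s x = inv x \<otimes> s" for s x
    have finT: "finite T" using X by (simp add: T_def finite_restricted_sumset)
    have TG: "s \<in> carrier G" if "s \<in> T" for s
      using that XG by (auto simp: T_def restricted_sumset_def)
    have finR: "finite (R s)" for s using X by (simp add: R_def)
    have q_eq: "q (x \<otimes> y) x = y" if "x \<in> X" "y \<in> X" for x y
      using that XG by (auto simp: q_def subset_iff m_assoc[symmetric])
    have Rq: "q s x \<in> X \<and> x \<noteq> q s x \<and> x \<otimes> q s x = s" if "x \<in> R s" for s x
      using that q_eq by (auto simp: R_def)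
    define \<tau> where "\<tau> = \<epsilon>\<^sup>2 * k\<^sup>2 / (16 * m)"
    define S where "S = {s \<in> T. \<tau> \<le> real (card (R s))}"
    have p\<tau>: "p\<^sup>2 * \<tau> = 4 * ln m"
      using m(2) lnm k \<epsilon> by (simp add: p_def \<tau>_def power_mult_distrib power_divide field_simps)
    have "(\<Sum>s\<in>S. (1 - p\<^sup>2) ^ card (R s)) \<le> (\<Sum>s\<in>S. 1 / m ^ 4)"
    proof (rule sum_mono)
      fix s assume "s \<in> S"
      have "(1 - p\<^sup>2) ^ card (R s) \<le> exp (- p\<^sup>2) ^ card (R s)"
        using exp_ge_add_one_self[of "- p\<^sup>2"] True p0 by (intro power_mono) (auto simp: power_le_one)
      also have "\<dots> = exp (- (p\<^sup>2 * real (card (R s))))"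
        by (simp add: exp_of_nat_mult[symmetric] mult.commute)
      also have "\<dots> \<le> exp (- (p\<^sup>2 * \<tau>))"
        using \<open>s \<in> S\<close> by (auto simp: S_def intro: mult_left_mono)
      also have "\<dots> = 1 / exp (ln m) ^ 4"
        by (simp only: p\<tau> exp_minus exp_of_nat_mult[symmetric] inverse_eq_divide of_nat_numeral)
      also have "\<dots> = 1 / m ^ 4" using m(2) by simp
      finally show "(1 - p\<^sup>2) ^ card (R s) \<le> 1 / m ^ 4" .
    qed
    also have "\<dots> = real (card S) / m ^ 4" by simp
    also have "\<dots> \<le> m / m ^ 4"
    proof (rule divide_right_mono)
      have "card S \<le> card T" using finT by (intro card_mono) (auto simp: S_def)
      then show "real (card S) \<le> m" using m(1) by (simp add: T_def)
    qed (use m(2) in simp)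
    also have "\<dots> = 1 / m ^ 3" using m(2) by (simp add: field_simps eval_nat_numeral)
    also have "\<dots> \<le> 1 / 2 ^ 3" using m(2) by (intro divide_left_mono power_mono) auto
    also have "\<dots> < 1 / 2" by simp
    finally have small: "(\<Sum>s\<in>S. (1 - p\<^sup>2) ^ card (R s)) < 1 / 2" .
    obtain A B where AB: "A \<subseteq> X" "B \<subseteq> X" "real (card A) + real (card B) \<le> 4 * p * real (card X)"
      and hit: "\<And>s. s \<in> S \<Longrightarrow> \<exists>x\<in>R s. x \<in> A \<and> q s x \<in> B"
    proof (rule Bernoulli_pair_hitting[OF X p0 True, of S R q])
      show "finite S" using finT by (simp add: S_def)
      show "inj_on (q s) (R s)" if "s \<in> S" for s
      proof (rule inj_onI)
        fix x y assume xy: "x \<in> R s" "y \<in> R s" "q s x = q s y"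
        then have "x \<otimes> q s x = y \<otimes> q s x" using Rq by metis
        moreover have "x \<in> carrier G" "y \<in> carrier G" "q s x \<in> carrier G"
          using xy Rq[of x s] XG by (auto simp: R_def)
        ultimately show "x = y" by simp
      qed
      show "q s ` R s \<subseteq> X" for s using Rq by auto
    qed (use small in \<open>auto simp: R_def\<close>)
    define F where "F = A \<union> B"
    have captured: "s \<in> restricted_sumset G F" if "s \<in> S" for s
    proof -
      from hit[OF that] obtain x where x: "x \<in> R s" "x \<in> A" "q s x \<in> B" by blast
      then show ?thesis
        unfolding restricted_sumset_def F_def using Rq[OF x(1)]
        by (intro CollectI exI[of _ x] exI[of _ "q s x"]) auto
    qed
    show thesis
    proof (rule that[of F])
      show "F \<subseteq> X" using AB by (simp add: F_def)
      have "real (card F) \<le> real (card A + card B)"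
        unfolding F_def by (intro of_nat_mono card_Un_le)
      with AB(3) show "real (card F) \<le> 32 * inverse \<epsilon> * sqrt (m * ln m)"
        unfolding L by (simp add: k_def)
      define N where "N = {(x, y) \<in> X \<times> X. x \<noteq> y \<and> x \<otimes> y \<notin> restricted_sumset G F}"
      \<comment> \<open>A missed pair is determined by its sum, which is unpopular, and its first
        entry.\<close>
      have "N \<subseteq> (\<lambda>(s, x). (x, q s x)) ` (SIGMA s:T - S. R s)"
      proof
        fix z assume "z \<in> N"
        then obtain x y where xy: "z = (x, y)" "x \<in> X" "y \<in> X" "x \<noteq> y" "x \<otimes> y \<notin> restricted_sumset G F"
          by (auto simp: N_def)
        then have "x \<otimes> y \<notin> S" using captured by blast
        moreover have "x \<otimes> y \<in> T" "x \<in> R (x \<otimes> y)"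
          using xy(2-4) by (auto simp: T_def restricted_sumset_def R_def)
        ultimately show "z \<in> (\<lambda>(s, x). (x, q s x)) ` (SIGMA s:T - S. R s)"
          using xy q_eq by (intro image_eqI[of _ _ "(x \<otimes> y, x)"]) auto
      qed
      then have "card N \<le> card (SIGMA s:T - S. R s)"
        using finT finR by (intro surj_card_le) auto
      also have "\<dots> = (\<Sum>s\<in>T - S. card (R s))"
        using finT finR by simp
      finally have "real (card N) \<le> (\<Sum>s\<in>T - S. real (card (R s)))"
        by (metis of_nat_le_iff of_nat_sum)
      also have "\<dots> \<le> (\<Sum>s\<in>T - S. \<tau>)"
        by (rule sum_mono) (auto simp: S_def)
      also have "\<dots> = real (card (T - S)) * \<tau>" by simp
      also have "\<dots> \<le> m * \<tau>"
      proof (rule mult_right_mono)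
        have "card (T - S) \<le> card T" using finT by (intro card_mono) auto
        then show "real (card (T - S)) \<le> m" using m(1) by (simp add: T_def)
      qed (use m(2) in \<open>simp add: \<tau>_def\<close>)
      also have "\<dots> = \<epsilon>\<^sup>2 * k\<^sup>2 / 16" using m(2) by (simp add: \<tau>_def)
      finally show "real (card {(x, y) \<in> X \<times> X. x \<noteq> y \<and> x \<otimes> y \<notin> restricted_sumset G F})
          \<le> \<epsilon>\<^sup>2 * (real (card X))\<^sup>2 / 16"
        by (simp add: N_def k_def)
    qed
  qed
qed

text \<open>Points \<open>y\<close> with many uncaptured sums are few and can be deleted; robustness
  keeps the dimension of the rest at least \<open>d\<close>, so the partial sumset bound applies to
  the captured pairs.\<close>

lemma fingerprint_of_robust_freiman_dim:
  fixes G (structure)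
  assumes G: "group G" and XG: "X \<subseteq> carrier G" and X: "finite X" "X \<noteq> {}"
    and m: "real (card (restricted_sumset G X)) \<le> m" "m \<ge> 2"
    and \<epsilon>: "0 < \<epsilon>" "\<epsilon> < 1" "32 / real (card X) < \<epsilon>"
    and robust: "robust_freiman_dim G \<epsilon> X d" and "d > 0"
  obtains F where "F \<subseteq> X" "real (card F) \<le> 32 * inverse \<epsilon> * sqrt (m * ln m)"
    "(1 - \<epsilon>) * (real d + 1) * real (card X) / 2 \<le> real (card (restricted_sumset G F))"
proof -
  define k where "k = real (card X)"
  have k: "k > 0" using X by (simp add: k_def card_gt_0_iff)
  obtain F where F: "F \<subseteq> X" "real (card F) \<le> 32 * inverse \<epsilon> * sqrt (m * ln m)"
    and N_le: "real (card {(x, y) \<in> X \<times> X. x \<noteq> y \<and> x \<otimes> y \<notin> restricted_sumset G F}) \<le> \<epsilon>\<^sup>2 * k\<^sup>2 / 16"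
    using exists_fingerprint[OF G XG X m \<epsilon>(1)] unfolding k_def by blast
  define S where "S = restricted_sumset G F"
  define miss where "miss y = {x \<in> X. x \<noteq> y \<and> x \<otimes> y \<notin> S}" for y
  define X' where "X' = {y \<in> X. real (card (miss y)) \<le> \<epsilon> * k / 8}"
  have fin: "finite (miss y)" "finite X'" for y using X by (simp_all add: miss_def X'_def)
  \<comment> \<open>Markov's inequality: each deleted point accounts for more than
    \<open>\<epsilon> * k / 8\<close> of the at most
    \<open>\<epsilon>\<^sup>2 * k\<^sup>2 / 16\<close> missed pairs.\<close>
  have "real (card (X - X')) * (\<epsilon> * k / 8) = (\<Sum>y\<in>X - X'. \<epsilon> * k / 8)" by simp
  also have "\<dots> \<le> (\<Sum>y\<in>X - X'. real (card (miss y)))"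
    by (rule sum_mono) (auto simp: X'_def)
  also have "\<dots> \<le> (\<Sum>y\<in>X. real (card (miss y)))"
    by (rule sum_mono2) (use X in auto)
  also have "\<dots> = real (card (SIGMA y:X. miss y))"
    using X fin by simp
  also have "(SIGMA y:X. miss y) = prod.swap ` {(x, y) \<in> X \<times> X. x \<noteq> y \<and> x \<otimes> y \<notin> S}"
    by (auto simp: miss_def)
  also have "real (card \<dots>) \<le> \<epsilon>\<^sup>2 * k\<^sup>2 / 16"
    using N_le by (subst card_image) (auto simp: S_def)
  finally have "real (card (X - X')) * (\<epsilon> * k / 8) \<le> (\<epsilon> * k / 2) * (\<epsilon> * k / 8)"
    by (simp add: power2_eq_square mult_ac)
  then have "real (card (X - X')) \<le> \<epsilon> * k / 2"
    using \<epsilon>(1) k by (subst (asm) mult_le_cancel_right_pos) auto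
  moreover have "real (card X) = real (card X') + real (card (X - X'))"
    using X fin(2) by (subst of_nat_add[symmetric], subst card_Un_disjoint[symmetric])
      (auto simp: X'_def intro!: arg_cong[where f = card])
  ultimately have cardX': "(1 - \<epsilon> / 2) * k \<le> real (card X')"
    by (simp add: k_def left_diff_distrib)
  have "(1 - \<epsilon>) * k \<le> (1 - \<epsilon> / 2) * k" using \<epsilon>(1) k by (intro mult_right_mono) auto
  with cardX' have "(1 - \<epsilon>) * k \<le> real (card X')" by linarith
  then have dim: "d \<le> freiman_dim G X'"
    using robust unfolding robust_freiman_dim_def k_def
    by (metis (no_types, lifting) X'_def mem_Collect_eq not_less subsetI)
  have "0 < (1 - \<epsilon> / 2) * k" using \<epsilon>(2) k by simp
  with cardX' have "X' \<noteq> {}" by auto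
  have "real (d + 1) * (real (card X') / 2 - \<epsilon> * k / 4)
      \<le> real (card {x \<otimes> t | x t. x \<in> X' \<and> t \<in> X' \<and> (x, t) \<in> {(x, t). x \<noteq> t \<and> x \<otimes> t \<in> S}})"
  proof (rule card_partial_sumset_ge[OF fin(2) \<open>X' \<noteq> {}\<close> dim \<open>d > 0\<close>])
    fix t assume "t \<in> X'"
    \<comment> \<open>The diagonal pair \<open>(t, t)\<close> adds one miss, absorbed because
      \<open>\<epsilon> * k > 32\<close>.\<close>
    have "card {x \<in> X'. (x, t) \<notin> {(x, t). x \<noteq> t \<and> x \<otimes> t \<in> S}} \<le> card (insert t (miss t))"
      by (rule card_mono) (use fin in \<open>auto simp: miss_def X'_def\<close>)
    also have "\<dots> \<le> card (miss t) + 1"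
      by (simp add: card_insert_if fin)
    finally have "real (card {x \<in> X'. (x, t) \<notin> {(x, t). x \<noteq> t \<and> x \<otimes> t \<in> S}}) \<le> \<epsilon> * k / 8 + 1"
      using \<open>t \<in> X'\<close> by (auto simp: X'_def)
    moreover have "32 < \<epsilon> * k" using \<epsilon>(3) k by (simp add: k_def divide_less_eq)
    ultimately show "real (card {x \<in> X'. (x, t) \<notin> {(x, t). x \<noteq> t \<and> x \<otimes> t \<in> S}}) \<le> \<epsilon> * k / 4"
      by linarith
  next
    have "\<epsilon> * k \<le> k" using \<epsilon>(2) k by simp
    then show "\<epsilon> * k / 4 \<le> real (card X') / 2" using cardX' by (simp add: algebra_simps)
  qed
  also have "\<dots> \<le> real (card S)"
    using F(1) X unfolding S_def
    by (intro of_nat_mono card_mono finite_restricted_sumset) (auto intro: finite_subset)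
  finally have "real (d + 1) * (real (card X') / 2 - \<epsilon> * k / 4) \<le> real (card S)" .
  \<comment> \<open>Deletion and missed pairs each cost \<open>\<epsilon> * k / 4\<close>.\<close>
  moreover have "(1 - \<epsilon>) * k / 2 \<le> real (card X') / 2 - \<epsilon> * k / 4"
    using cardX' by (simp add: left_diff_distrib)
  then have "real (d + 1) * ((1 - \<epsilon>) * k / 2) \<le> real (d + 1) * (real (card X') / 2 - \<epsilon> * k / 4)"
    by (rule mult_left_mono) simp
  ultimately have "real (d + 1) * ((1 - \<epsilon>) * k / 2) \<le> real (card S)" by linarith
  also have "real (d + 1) * ((1 - \<epsilon>) * k / 2) = (1 - \<epsilon>) * (real d + 1) * k / 2" by simp
  finally show thesis
    using that[OF F] by (simp add: S_def k_def)
qed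

section \<open>Progressions and the final assembly\<close>

lemma is_gap_subset_carrier:
  fixes G (structure)
  assumes "comm_group G" "is_gap G d P"
  shows "P \<subseteq> carrier G"
proof -
  interpret comm_group G by fact
  from assms(2) obtain a l where a: "\<And>i. i \<in> {0..d} \<Longrightarrow> a i \<in> carrier G"
    and P: "P = {a 0 \<otimes> finprod G (\<lambda>i. a i [^] w i) {1..d} | w :: nat \<Rightarrow> int.
               \<forall>i\<in>{1..d}. 0 \<le> w i \<and> w i < int (l i)}"
    unfolding is_gap_def by blast
  show ?thesis
    unfolding P by (auto intro!: m_closed finprod_closed int_pow_closed a)
qed

text \<open>The progression is a single point. This excludes \<open>d = 0\<close>, where a lower
  bound on the Freiman dimension carries no information.\<close>

lemma is_gap_0_card_le:
  fixes G (structure)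
  assumes "comm_group G" "is_gap G 0 P" "X \<subseteq> P"
  shows "card X \<le> 1"
proof -
  interpret comm_group G by fact
  from assms(2,3) obtain a where "X \<subseteq> {a}"
    unfolding is_gap_def by auto
  then show ?thesis by (auto dest!: subset_singletonD)
qed

theorem theorem2p1:
  shows "\<exists>n\<^sub>0 :: nat. \<forall>\<gamma> :: real. 0 < \<gamma> \<and> \<gamma> < 1/2 \<longrightarrow>
    (\<exists>C :: real. C > 0 \<and>
      (\<forall>(n :: nat) (k :: nat) (d :: nat) (m :: real) (\<epsilon> :: real) (P :: int set).
        prime n \<and> n \<ge> n\<^sub>0 \<and> k \<ge> 1 \<and>
        m \<ge> (real d + 1) * real k / 2 \<and> C / real k < \<epsilon> \<and> \<epsilon> < \<gamma> \<and>
        is_gap (integer_mod_group n) d P \<longrightarrow>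
        (\<exists>\<F> :: int set set.
          (\<forall>F\<in>\<F>. F \<subseteq> P) \<and>
          (\<forall>F\<in>\<F>.
             real (card F) \<le> C * inverse \<epsilon> * sqrt (m * ln m) \<and>
             real (card (restricted_sumset (integer_mod_group n) F))
               \<ge> (1 - \<gamma>) * (real d + 1) * real k / 2) \<and>
          (\<forall>X. X \<subseteq> P \<and> card X = k \<and>
               real (card (restricted_sumset (integer_mod_group n) X)) \<le> m \<and>
               robust_freiman_dim (integer_mod_group n) \<epsilon> X d
             \<longrightarrow> (\<exists>F\<in>\<F>. F \<subseteq> X)))))"
\<comment> \<open>The threshold 0 for \<open>n\<close> and the constant \<open>C = 32\<close> work
  for every \<open>\<gamma>\<close>.\<close>
proof (rule exI[of _ 0], intro allI impI, rule exI[of _ 32], intro conjI allI impI, goal_cases)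
  case 1
  show ?case by simp
next
  case (2 \<gamma> n k d m \<epsilon> P)
  define G where "G = integer_mod_group n"
  have G: "comm_group G" "group G" by (simp_all add: G_def)
  have k: "k \<ge> 1" and m: "m \<ge> (real d + 1) * real k / 2" and \<epsilon>: "32 / real k < \<epsilon>" "\<epsilon> < \<gamma>" "\<gamma> < 1 / 2"
    and gap: "is_gap G d P"
    using 2 by (auto simp: G_def)
  have \<epsilon>0: "\<epsilon> > 0" using \<epsilon>(1) by (rule le_less_trans[rotated]) simp
  have "32 / real k < 1 / 2" using \<epsilon> by simp
  then have k64: "real k > 64" using k by (simp add: divide_less_eq)
  \<comment> \<open>Taking all subsets of \<open>P\<close> that satisfy (a) leaves only (b) to
    prove.\<close>
  define \<F> where "\<F> = {F. F \<subseteq> P \<and> real (card F) \<le> 32 * inverse \<epsilon> * sqrt (m * ln m) \<and>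
      real (card (restricted_sumset G F)) \<ge> (1 - \<gamma>) * (real d + 1) * real k / 2}"
  have "\<exists>F\<in>\<F>. F \<subseteq> X"
    if X: "X \<subseteq> P" "card X = k" "real (card (restricted_sumset G X)) \<le> m"
      and robust: "robust_freiman_dim G \<epsilon> X d" for X
  proof -
    have "d > 0"
      using is_gap_0_card_le[OF G(1) _ X(1)] gap X(2) k64 by (cases "d = 0") auto
    have fin: "finite X" "X \<noteq> {}" using X(2) k by (auto intro: card_ge_0_finite)
    have XG: "X \<subseteq> carrier G" using X(1) is_gap_subset_carrier[OF G(1) gap] by blast
    have "(real d + 1) * real k \<ge> 1 * real k" by (rule mult_right_mono) auto
    with m k64 have "m \<ge> 2" by linarith
    obtain F where F: "F \<subseteq> X" "real (card F) \<le> 32 * inverse \<epsilon> * sqrt (m * ln m)"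
      "(1 - \<epsilon>) * (real d + 1) * real k / 2 \<le> real (card (restricted_sumset G F))"
      using fingerprint_of_robust_freiman_dim[OF G(2) XG fin X(3) \<open>m \<ge> 2\<close> \<epsilon>0 _ _ robust \<open>d > 0\<close>] \<epsilon> X(2)
      by auto
    have "(1 - \<gamma>) * (real d + 1) * real k \<le> (1 - \<epsilon>) * (real d + 1) * real k"
      using \<epsilon>(2) by (intro mult_right_mono) auto
    with F(3) have "(1 - \<gamma>) * (real d + 1) * real k / 2 \<le> real (card (restricted_sumset G F))" by linarith
    with F(1,2) X(1) have "F \<in> \<F>" by (auto simp: \<F>_def)
    with F(1) show ?thesis by blast
  qed
  then show ?case
    unfolding G_def[symmetric] by (intro exI[of _ \<F>]) (auto simp: \<F>_def)
qed

end
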